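(* Let $q$ be a prime, $a\in\mathbb{Z}_q$, let $f^{[a]}:\Omega_a\to\mathbb{Z}_q$ be a quadratic partial function of $n+1$ arguments $x_1,\ldots,x_n,x_0$, and let $W\subset\{1,\ldots,n,0\}$. Then $f^{[a]}$ is $W$-separable if and only if the vertex set $W$ is separable in the graphs of the quadratic polynomials representing $f^{[a]}$ (that is, in the graph of every quadratic polynomial representing $f^{[a]}$).
   Context: Let $q$ be prime and identify $\{0,\ldots,q-1\}$ with the field $\mathbb{Z}_q$. For $a\in\mathbb{Z}_q$ put $\Omega_a=\{(x_1,\ldots,x_n,x_0)\in\mathbb{Z}_q^{n+1}\mid \sum_{i=0}^n x_i=a\}$. A partial function (of $n+1$ arguments) is a function $f^{[a]}:\Omega_a\to\mathbb{Z}_q$. For $W\subset\{1,\ldots,n,0\}$ and $U=\{1,\ldots,n,0\}\setminus W$, the partial function $f^{[a]}$ is $W$-separable if $f^{[a]}(x_1,\ldots,x_n,x_0)=f'(x_W)+f''(x_U)$ for all $(x_1,\ldots,x_n,x_0)\in\Omega_a$, for some everywhere defined $\mathbb{Z}_q$-valued functions $f',f''$ of $|W|$ and $|U|$ arguments in $\mathbb{Z}_q$, where $x_C$ denotes the tuple of variables with indices in $C$. The degree of a partial function is the minimal degree of a polynomial over $\mathbb{Z}_q$ in $x_1,\ldots,x_n,x_0$ representing it (i.e. coinciding with it on $\Omega_a$). "Quadratic" means of degree at most $2$. The graph of a quadratic polynomial in $x_1,\ldots,x_n,x_0$ is the edge-weighted graph on the vertex set $\{1,\ldots,n,0\}$ in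 which the weight of the edge joining two distinct vertices $i,j$ equals the coefficient of $x_ix_j$ in the polynomial. A graph $G=(V,E)$ consists of a finite vertex set $V$ and a symmetric map $E:V^2\to\{0,1,\ldots,q-1\}$ vanishing on the diagonal; $E(v,w)$ is the weight of the edge $\{v,w\}$, weight $0$ meaning absence of an edge. The sum of two graphs on the same vertex set is obtained by adding edge weights modulo $q$. A graph is additive if its vertices can be labelled by numbers from $\{0,\ldots,q-1\}$ so that the weight of each edge (pair of distinct vertices) equals the sum modulo $q$ of the labels of its two vertices. A switching of $G$ is the sum of $G$ with some additive graph on the same vertex set. A set $W\subset V$ is separable in $G$ if some switching of $G$ has no edges (of nonzero weight) between $W$ and $V\setminus W$. *)

theory Defs
  imports
    "HOL-Library.FuncSet"
    "HOL-Library.Poly_Mapping"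
    "Berlekamp_Zassenhaus.Finite_Field"
begin

text \<open>
  The field of residues modulo a prime \<open>q\<close> is \<open>'q mod_ring\<close> for a type \<open>'q :: prime_card\<close>, i.e. a
  finite type with \<open>q = CARD('q)\<close> prime; its elements are represented by \<open>0, \<dots>, q - 1\<close>.
  Argument positions \<open>1, \<dots>, n, 0\<close> are the natural numbers in \<open>{..n}\<close>, and a tuple of variables with
  indices in \<open>C\<close> is an element of \<open>C \<rightarrow>\<^sub>E UNIV\<close>.
\<close>

subsection \<open>Polynomials in several variables\<close>

text \<open>Monomials are exponent vectors; a polynomial maps each monomial to its coefficient.\<close>

type_synonym monomial = "nat \<Rightarrow>\<^sub>0 nat"
type_synonym 'a mpolynomial = "monomial \<Rightarrow>\<^sub>0 'a"

definition monomial_degree :: "monomial \<Rightarrow> nat" where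
  "monomial_degree m = (\<Sum>i\<in>Poly_Mapping.keys m. Poly_Mapping.lookup m i)"

text \<open>The zero polynomial gets degree \<open>0\<close>.\<close>

definition total_degree :: "'a::zero mpolynomial \<Rightarrow> nat" where
  "total_degree p = Max (insert 0 (monomial_degree ` Poly_Mapping.keys p))"

definition poly_vars :: "'a::zero mpolynomial \<Rightarrow> nat set" where
  "poly_vars p = (\<Union>m\<in>Poly_Mapping.keys p. Poly_Mapping.keys m)"

definition eval_poly :: "'a::comm_semiring_1 mpolynomial \<Rightarrow> (nat \<Rightarrow> 'a) \<Rightarrow> 'a" where
  "eval_poly p x = (\<Sum>m\<in>Poly_Mapping.keys p. Poly_Mapping.lookup p m *
     (\<Prod>i\<in>Poly_Mapping.keys m. x i ^ Poly_Mapping.lookup m i))"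

subsection \<open>Partial functions\<close>

definition Omega :: "nat \<Rightarrow> 'q::prime_card mod_ring \<Rightarrow> (nat \<Rightarrow> 'q mod_ring) set" where
  "Omega n a = {x \<in> {..n} \<rightarrow>\<^sub>E UNIV. (\<Sum>i\<le>n. x i) = a}"

text \<open>
  A partial function is given by a total function \<open>f\<close> on \<open>nat \<Rightarrow> 'q mod_ring\<close>. Everything below
  depends only on the restriction of \<open>f\<close> to \<open>Omega n a\<close>.
\<close>

definition separable_pfun ::
  "nat \<Rightarrow> 'q::prime_card mod_ring \<Rightarrow> nat set \<Rightarrow> ((nat \<Rightarrow> 'q mod_ring) \<Rightarrow> 'q mod_ring) \<Rightarrow> bool" where
  "separable_pfun n a W f \<longleftrightarrow>
     (\<exists>f' f'' :: (nat \<Rightarrow> 'q mod_ring) \<Rightarrow> 'q mod_ring. \<forall>x\<in>Omega n a.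
        f x = f' (restrict x W) + f'' (restrict x ({..n} - W)))"

definition represents ::
  "nat \<Rightarrow> 'q::prime_card mod_ring \<Rightarrow> 'q mod_ring mpolynomial \<Rightarrow>
   ((nat \<Rightarrow> 'q mod_ring) \<Rightarrow> 'q mod_ring) \<Rightarrow> bool" where
  "represents n a p f \<longleftrightarrow> poly_vars p \<subseteq> {..n} \<and> (\<forall>x\<in>Omega n a. eval_poly p x = f x)"

text \<open>
  The set of degrees below is never empty, since every function on a subset of a finite vector space
  over a finite field is represented by a polynomial.
\<close>

definition pfun_degree ::
  "nat \<Rightarrow> 'q::prime_card mod_ring \<Rightarrow> ((nat \<Rightarrow> 'q mod_ring) \<Rightarrow> 'q mod_ring) \<Rightarrow> nat" where
  "pfun_degree n a f = (LEAST d. \<exists>p. represents n a p f \<and> total_degree p = d)"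

definition quadratic_pfun ::
  "nat \<Rightarrow> 'q::prime_card mod_ring \<Rightarrow> ((nat \<Rightarrow> 'q mod_ring) \<Rightarrow> 'q mod_ring) \<Rightarrow> bool" where
  "quadratic_pfun n a f \<longleftrightarrow> pfun_degree n a f \<le> 2"

definition quadratic_poly :: "'a::zero mpolynomial \<Rightarrow> bool" where
  "quadratic_poly p \<longleftrightarrow> total_degree p \<le> 2"

subsection \<open>Edge-weighted graphs\<close>

record ('v, 'q) wgraph =
  verts :: "'v set"
  weight :: "'v \<Rightarrow> 'v \<Rightarrow> 'q mod_ring"

text \<open>
  Weights of pairs outside the vertex set are fixed to be \<open>0\<close>, so that equality of records is
  equality of graphs.
\<close>

definition is_wgraph :: "('v, 'q::prime_card) wgraph \<Rightarrow> bool" where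
  "is_wgraph G \<longleftrightarrow> finite (verts G) \<and>
     (\<forall>v\<in>verts G. \<forall>w\<in>verts G. weight G v w = weight G w v) \<and>
     (\<forall>v\<in>verts G. weight G v v = 0) \<and>
     (\<forall>v w. v \<notin> verts G \<or> w \<notin> verts G \<longrightarrow> weight G v w = 0)"

text \<open>Only meant for graphs with the same vertex set.\<close>

definition graph_sum ::
  "('v, 'q::prime_card) wgraph \<Rightarrow> ('v, 'q) wgraph \<Rightarrow> ('v, 'q) wgraph" where
  "graph_sum G H = \<lparr>verts = verts G, weight = (\<lambda>v w. weight G v w + weight H v w)\<rparr>"

definition additive_graph :: "('v, 'q::prime_card) wgraph \<Rightarrow> bool" where
  "additive_graph G \<longleftrightarrow> is_wgraph G \<and>
     (\<exists>l :: 'v \<Rightarrow> 'q mod_ring. \<forall>v\<in>verts G. \<forall>w\<in>verts G. v \<noteq> w \<longrightarrow> weight G v w = l v + l w)"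

definition is_switching :: "('v, 'q::prime_card) wgraph \<Rightarrow> ('v, 'q) wgraph \<Rightarrow> bool" where
  "is_switching H G \<longleftrightarrow> (\<exists>A. additive_graph A \<and> verts A = verts G \<and> H = graph_sum G A)"

definition separable_in :: "'v set \<Rightarrow> ('v, 'q::prime_card) wgraph \<Rightarrow> bool" where
  "separable_in W G \<longleftrightarrow> W \<subseteq> verts G \<and>
     (\<exists>H. is_switching H G \<and> (\<forall>v\<in>W. \<forall>w\<in>verts G - W. weight H v w = 0))"

definition poly_graph :: "nat \<Rightarrow> 'q::prime_card mod_ring mpolynomial \<Rightarrow> (nat, 'q) wgraph" where
  "poly_graph n p =
     \<lparr>verts = {..n},
      weight = (\<lambda>i j. if i \<in> {..n} \<and> j \<in> {..n} \<and> i \<noteq> j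
        then Poly_Mapping.lookup p (Poly_Mapping.single i 1 + Poly_Mapping.single j 1) else 0)\<rparr>"

lemma is_wgraph_poly_graph: "is_wgraph (poly_graph n p)"
  by (auto simp: is_wgraph_def poly_graph_def add.commute)

end

theory Submission
  imports Defs
begin

text \<open>
  Let \<open>U = {..n} - W\<close>. A monomial of degree at most \<open>2\<close> either has all its variables in \<open>W\<close>, or all of
  them in \<open>U\<close>, or is a product \<open>x v * x w\<close> with \<open>v \<in> W\<close> and \<open>w \<in> U\<close>. A quadratic polynomial is thus
  a function of \<open>x\<^sub>W\<close> plus a function of \<open>x\<^sub>U\<close> plus the bilinear form
  \<open>\<Sum>v\<in>W. \<Sum>w\<in>U. E v w * x v * x w\<close>, where \<open>E\<close> is the weight function of its graph
  (\<open>eval_poly_quadratic_split\<close>). Only this form matters for separability, and separability of \<open>W\<close> in the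
  graph says that \<open>E v w = l v + l w\<close> between \<open>W\<close> and \<open>U\<close> for some labels \<open>l\<close>
  (\<open>separable_in_poly_graph_iff\<close>).

  If \<open>E v w = l v + l w\<close>, the form equals
  \<open>(\<Sum>v\<in>W. l v * x v) * (\<Sum>w\<in>U. x w) + (\<Sum>v\<in>W. x v) * (\<Sum>w\<in>U. l w * x w)\<close>. On \<open>Omega n a\<close> the sum
  over \<open>U\<close> in the first summand is \<open>a\<close> minus the sum over \<open>W\<close>, and likewise in the second one, so the
  form is separable (\<open>bilinear_separable_if_labels\<close>).
  Conversely, evaluating a separable form at points supported on one \<open>v \<in> W\<close>, one \<open>w \<in> U\<close> and a fixed
  \<open>w0 \<in> U\<close> that corrects the coordinate sum reads off the labels (\<open>labels_if_bilinear_separable\<close>).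

  The second direction applies to every quadratic polynomial representing \<open>f\<close>; the first one needs at
  least one. As the degree of \<open>f\<close> is the least element of the set of degrees of
  its representing polynomials, it has to be shown that this set is inhabited, which is Lagrange
  interpolation over a finite field (\<open>ex_represents\<close>).
\<close>

section \<open>Every partial function is represented by a polynomial\<close>

definition polynomial_function :: "nat \<Rightarrow> ((nat \<Rightarrow> 'a::comm_ring_1) \<Rightarrow> 'a) \<Rightarrow> bool" where
  "polynomial_function n g \<longleftrightarrow> (\<exists>p. poly_vars p \<subseteq> {..n} \<and> (\<forall>x. eval_poly p x = g x))"

lemma eval_poly_superset:
  assumes "finite K" "Poly_Mapping.keys p \<subseteq> K"
  shows "eval_poly p x = (\<Sum>m\<in>K. Poly_Mapping.lookup p m *
     (\<Prod>i\<in>Poly_Mapping.keys m. x i ^ Poly_Mapping.lookup m i))"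
  unfolding eval_poly_def
  by (rule sum.mono_neutral_left) (use assms in \<open>auto simp: in_keys_iff\<close>)

lemma eval_poly_add: "eval_poly (p + q) x = eval_poly p x + eval_poly q x"
proof -
  let ?K = "Poly_Mapping.keys p \<union> Poly_Mapping.keys q"
  have "eval_poly (p + q) x = (\<Sum>m\<in>?K. Poly_Mapping.lookup (p + q) m *
     (\<Prod>i\<in>Poly_Mapping.keys m. x i ^ Poly_Mapping.lookup m i))"
    by (rule eval_poly_superset) (use Poly_Mapping.keys_add[of p q] in auto)
  then show ?thesis
    by (simp add: lookup_add distrib_right sum.distrib
        eval_poly_superset[of ?K p] eval_poly_superset[of ?K q])
qed

lemma polynomial_function_add:
  assumes "polynomial_function n g" "polynomial_function n h"
  shows "polynomial_function n (\<lambda>x. g x + h x)"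
proof -
  obtain p q where "poly_vars p \<subseteq> {..n}" "\<forall>x. eval_poly p x = g x"
    and "poly_vars q \<subseteq> {..n}" "\<forall>x. eval_poly q x = h x"
    using assms unfolding polynomial_function_def by blast
  moreover have "poly_vars (p + q) \<subseteq> poly_vars p \<union> poly_vars q"
    using Poly_Mapping.keys_add[of p q] by (auto simp: poly_vars_def)
  ultimately show ?thesis
    unfolding polynomial_function_def by (intro exI[of _ "p + q"]) (auto simp: eval_poly_add)
qed

lemma polynomial_function_monomial:
  fixes c :: "'a::comm_ring_1"
  assumes "Poly_Mapping.keys m \<subseteq> {..n}"
  shows "polynomial_function n (\<lambda>x. c * (\<Prod>i\<le>n. x i ^ Poly_Mapping.lookup m i))"
  unfolding polynomial_function_def
proof (intro exI[of _ "Poly_Mapping.single m c"] conjI allI)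
  show "poly_vars (Poly_Mapping.single m c) \<subseteq> {..n}"
    using assms by (auto simp: poly_vars_def)
  fix x :: "nat \<Rightarrow> 'a"
  have "(\<Prod>i\<in>Poly_Mapping.keys m. x i ^ Poly_Mapping.lookup m i) =
        (\<Prod>i\<le>n. x i ^ Poly_Mapping.lookup m i)"
    by (rule prod.mono_neutral_left) (use assms in \<open>auto simp: in_keys_iff\<close>)
  then show "eval_poly (Poly_Mapping.single m c) x = c * (\<Prod>i\<le>n. x i ^ Poly_Mapping.lookup m i)"
    by (subst eval_poly_superset[of "{m}"]) auto
qed

lemma polynomial_function_const: "polynomial_function n (\<lambda>x. c)"
  using polynomial_function_monomial[of 0 n c] by simp

lemma polynomial_function_var:
  assumes "i \<le> n"
  shows "polynomial_function n (\<lambda>x :: nat \<Rightarrow> 'a::comm_ring_1. x i)"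
proof -
  have "(\<Prod>j\<le>n. x j ^ Poly_Mapping.lookup (Poly_Mapping.single i 1) j) = x i"
    for x :: "nat \<Rightarrow> 'a"
  proof -
    have "(\<Prod>j\<le>n. x j ^ Poly_Mapping.lookup (Poly_Mapping.single i 1) j) =
        (\<Prod>j\<le>n. if i = j then x j else 1)"
      by (rule prod.cong) (auto simp: lookup_single when_def)
    also have "\<dots> = x i"
      using assms by (simp add: prod.delta')
    finally show ?thesis .
  qed
  then show ?thesis
    using polynomial_function_monomial[of "Poly_Mapping.single i 1" n "1 :: 'a"] assms by simp
qed

lemma polynomial_function_sum:
  assumes "\<And>i. i \<in> A \<Longrightarrow> polynomial_function n (g i)"
  shows "polynomial_function n (\<lambda>x. \<Sum>i\<in>A. g i x)"
  using assms
  by (induction A rule: infinite_finite_induct)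
    (auto intro: polynomial_function_add polynomial_function_const)

text \<open>
  Taking all products of powers over the fixed index set \<open>{..n}\<close>, instead of over the variables that
  occur in the monomial, makes them multiply by adding exponents. Closure under products then follows
  from distributivity, without evaluating a product of polynomials.
\<close>

lemma polynomial_functionE:
  fixes g :: "(nat \<Rightarrow> 'a::comm_ring_1) \<Rightarrow> 'a"
  assumes "polynomial_function n g"
  obtains K :: "monomial set" and c :: "monomial \<Rightarrow> 'a"
  where "finite K" "\<forall>m\<in>K. Poly_Mapping.keys m \<subseteq> {..n}"
    "\<And>x. g x = (\<Sum>m\<in>K. c m * (\<Prod>i\<le>n. x i ^ Poly_Mapping.lookup m i))"
proof -
  obtain p where p: "poly_vars p \<subseteq> {..n}" "\<forall>x. eval_poly p x = g x"
    using assms unfolding polynomial_function_def by blast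
  have keys: "\<forall>m\<in>Poly_Mapping.keys p. Poly_Mapping.keys m \<subseteq> {..n}"
    using p(1) by (auto simp: poly_vars_def)
  have "g x = (\<Sum>m\<in>Poly_Mapping.keys p. Poly_Mapping.lookup p m *
      (\<Prod>i\<le>n. x i ^ Poly_Mapping.lookup m i))" for x
  proof -
    have "(\<Prod>i\<in>Poly_Mapping.keys m. x i ^ Poly_Mapping.lookup m i) =
        (\<Prod>i\<le>n. x i ^ Poly_Mapping.lookup m i)" if "m \<in> Poly_Mapping.keys p" for m
      by (rule prod.mono_neutral_left) (use keys that in \<open>auto simp: in_keys_iff\<close>)
    then show ?thesis
      unfolding p(2)[rule_format, symmetric] eval_poly_def by (intro sum.cong) auto
  qed
  with keys show thesis
    by (intro that[of "Poly_Mapping.keys p" "Poly_Mapping.lookup p"]) auto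
qed

lemma polynomial_function_mult:
  fixes g h :: "(nat \<Rightarrow> 'a::comm_ring_1) \<Rightarrow> 'a"
  assumes "polynomial_function n g" "polynomial_function n h"
  shows "polynomial_function n (\<lambda>x. g x * h x)"
proof -
  obtain K c where K: "finite K" "\<forall>m\<in>K. Poly_Mapping.keys m \<subseteq> {..n}"
    "\<And>x. g x = (\<Sum>m\<in>K. c m * (\<Prod>i\<le>n. x i ^ Poly_Mapping.lookup m i))"
    using polynomial_functionE[OF assms(1)] by metis
  obtain L d where L: "finite L" "\<forall>m\<in>L. Poly_Mapping.keys m \<subseteq> {..n}"
    "\<And>x. h x = (\<Sum>m\<in>L. d m * (\<Prod>i\<le>n. x i ^ Poly_Mapping.lookup m i))"
    using polynomial_functionE[OF assms(2)] by metis
  have "g x * h x = (\<Sum>k\<in>K. \<Sum>l\<in>L.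
      c k * d l * (\<Prod>i\<le>n. x i ^ Poly_Mapping.lookup (k + l) i))" for x
    unfolding K(3) L(3) sum_product
    by (intro sum.cong refl) (simp add: lookup_add power_add prod.distrib mult_ac)
  moreover have "polynomial_function n (\<lambda>x. \<Sum>k\<in>K. \<Sum>l\<in>L.
      c k * d l * (\<Prod>i\<le>n. x i ^ Poly_Mapping.lookup (k + l) i))"
  proof (intro polynomial_function_sum polynomial_function_monomial)
    fix k l
    assume "k \<in> K" "l \<in> L"
    then show "Poly_Mapping.keys (k + l) \<subseteq> {..n}"
      using K(2) L(2) Poly_Mapping.keys_add[of k l] by blast
  qed
  ultimately show ?thesis
    by simp
qed

lemma polynomial_function_prod:
  assumes "\<And>i. i \<in> A \<Longrightarrow> polynomial_function n (g i)"
  shows "polynomial_function n (\<lambda>x. \<Prod>i\<in>A. g i x)"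
  using assms
  by (induction A rule: infinite_finite_induct)
    (auto intro: polynomial_function_mult polynomial_function_const)

text \<open>
  The functions \<open>\<delta> c\<close> are the Lagrange basis polynomials of the grid of all tuples: over a finite
  field, a product of linear factors can vanish at every field element but \<open>c i\<close>, in each coordinate
  \<open>i\<close>.
\<close>

lemma polynomial_function_interpolation:
  fixes f :: "(nat \<Rightarrow> 'a::{field,finite}) \<Rightarrow> 'a"
  shows "\<exists>g. polynomial_function n g \<and> (\<forall>x\<in>{..n} \<rightarrow>\<^sub>E UNIV. g x = f x)"
proof -
  define \<delta> :: "(nat \<Rightarrow> 'a) \<Rightarrow> (nat \<Rightarrow> 'a) \<Rightarrow> 'a" where
    "\<delta> = (\<lambda>c x. \<Prod>i\<le>n. \<Prod>b\<in>UNIV - {c i}. inverse (c i - b) * (x i + - b))"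
  let ?X = "{..n} \<rightarrow>\<^sub>E (UNIV :: 'a set)"
  have \<delta>: "\<delta> c x = (if x = c then 1 else 0)" if cx: "c \<in> ?X" "x \<in> ?X" for c x
  proof (cases "x = c")
    case True
    then show ?thesis
      by (auto simp: \<delta>_def intro!: prod.neutral)
  next
    case False
    then obtain i where "i \<le> n" "x i \<noteq> c i"
      using PiE_ext[OF cx(2,1)] by auto
    then have "(\<Prod>b\<in>UNIV - {c i}. inverse (c i - b) * (x i + - b)) = 0"
      by (intro prod_zero) (auto intro!: bexI[of _ "x i"])
    with \<open>i \<le> n\<close> False show ?thesis
      by (auto simp: \<delta>_def intro!: prod_zero)
  qed
  have fin: "finite ?X"
    by (intro finite_PiE) auto
  have "(\<Sum>c\<in>?X. f c * \<delta> c x) = f x" if "x \<in> ?X" for x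
  proof -
    have "(\<Sum>c\<in>?X. f c * \<delta> c x) = (\<Sum>c\<in>?X. if x = c then f c else 0)"
      by (rule sum.cong) (auto simp: \<delta> that)
    also have "\<dots> = f x"
      using fin that by (simp add: sum.delta')
    finally show ?thesis .
  qed
  moreover have "polynomial_function n (\<lambda>x. \<Sum>c\<in>?X. f c * \<delta> c x)"
    unfolding \<delta>_def
    by (intro polynomial_function_sum polynomial_function_mult polynomial_function_prod
        polynomial_function_add polynomial_function_const polynomial_function_var) simp
  ultimately show ?thesis
    by (intro exI conjI ballI)
qed

lemma ex_represents:
  fixes a :: "'q::prime_card mod_ring"
  shows "\<exists>p. represents n a p f"
proof -
  obtain g where "polynomial_function n g" "\<forall>x\<in>{..n} \<rightarrow>\<^sub>E UNIV. g x = f x"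
    using polynomial_function_interpolation by blast
  then show ?thesis
    unfolding polynomial_function_def represents_def Omega_def by auto
qed

lemma quadratic_pfunE:
  assumes "quadratic_pfun n a f"
  obtains p where "quadratic_poly p" "represents n a p f"
proof -
  let ?P = "\<lambda>d. \<exists>p. represents n a p f \<and> total_degree p = d"
  have "?P (LEAST d. ?P d)"
    by (rule LeastI_ex) (use ex_represents in blast)
  then show thesis
    using assms that unfolding quadratic_pfun_def pfun_degree_def quadratic_poly_def by metis
qed

section \<open>The part of a quadratic polynomial joining two sets of variables\<close>

definition edge_coeff :: "'a::zero mpolynomial \<Rightarrow> nat \<Rightarrow> nat \<Rightarrow> 'a" where
  "edge_coeff p v w = Poly_Mapping.lookup p (Poly_Mapping.single v 1 + Poly_Mapping.single w 1)"

text \<open>Once \<open>x v * x w\<close> divides the monomial, the bound on the degree leaves no room for a cofactor.\<close>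

lemma monomial_eq_edge:
  assumes "monomial_degree m \<le> 2"
    and "v \<in> Poly_Mapping.keys m" "w \<in> Poly_Mapping.keys m" "v \<noteq> w"
  shows "m = Poly_Mapping.single v 1 + Poly_Mapping.single w 1"
proof -
  let ?r = "\<Sum>i\<in>Poly_Mapping.keys m - {v} - {w}. Poly_Mapping.lookup m i"
  have "monomial_degree m = Poly_Mapping.lookup m v + (Poly_Mapping.lookup m w + ?r)"
    unfolding monomial_degree_def
    by (subst sum.remove[of _ v], use assms in auto, subst sum.remove[of _ w], use assms in auto)
  moreover have "Poly_Mapping.lookup m v \<noteq> 0" "Poly_Mapping.lookup m w \<noteq> 0"
    using assms(2,3) by (auto simp: in_keys_iff)
  ultimately have vw: "Poly_Mapping.lookup m v = 1" "Poly_Mapping.lookup m w = 1" and "?r = 0"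
    using assms(1) by linarith+
  have other: "Poly_Mapping.lookup m i = 0" if "i \<noteq> v" "i \<noteq> w" for i
  proof (cases "i \<in> Poly_Mapping.keys m")
    case True
    with that \<open>?r = 0\<close> show ?thesis
      by (simp only: sum_eq_0_iff finite_Diff finite_keys) blast
  qed (simp add: in_keys_iff)
  show ?thesis
  proof (rule poly_mapping_eqI)
    fix i
    show "Poly_Mapping.lookup m i =
        Poly_Mapping.lookup (Poly_Mapping.single v 1 + Poly_Mapping.single w 1) i"
      using vw other[of i] \<open>v \<noteq> w\<close> by (auto simp: lookup_add lookup_single when_def)
  qed
qed

lemma eval_poly_quadratic_split:
  fixes p :: "'a::comm_semiring_1 mpolynomial"
  assumes "quadratic_poly p" "poly_vars p \<subseteq> W \<union> U" "W \<inter> U = {}" "finite W" "finite U"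
  obtains g h where "\<And>x. eval_poly p x =
    g (restrict x W) + h (restrict x U) + (\<Sum>v\<in>W. \<Sum>w\<in>U. edge_coeff p v w * x v * x w)"
proof -
  define K where "K = Poly_Mapping.keys p"
  define t where "t m x = Poly_Mapping.lookup p m *
    (\<Prod>i\<in>Poly_Mapping.keys m. x i ^ Poly_Mapping.lookup m i)" for m and x :: "nat \<Rightarrow> 'a"
  define A where "A = {m \<in> K. Poly_Mapping.keys m \<subseteq> W}"
  \<comment> \<open>The constant monomial has to be counted once only.\<close>
  define B where "B = {m \<in> K. Poly_Mapping.keys m \<subseteq> U \<and> \<not> Poly_Mapping.keys m \<subseteq> W}"
  define C where "C = K - A - B"
  define edge :: "nat \<times> nat \<Rightarrow> monomial" where
    "edge = (\<lambda>(v, w). Poly_Mapping.single v 1 + Poly_Mapping.single w 1)"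
  have fin: "finite K"
    by (simp add: K_def)
  have deg: "monomial_degree m \<le> 2" if "m \<in> K" for m
  proof -
    have "monomial_degree m \<le> total_degree p"
      using that fin by (auto simp: total_degree_def K_def)
    then show ?thesis
      using assms(1) by (simp add: quadratic_poly_def)
  qed
  have keys_edge: "Poly_Mapping.keys (edge (v, w)) = {v, w}" for v w
    by (auto simp: edge_def in_keys_iff lookup_add lookup_single when_def split: if_splits)
  have inj: "inj_on edge (W \<times> U)"
  proof (rule inj_onI, clarsimp)
    fix v w v' w'
    assume *: "v \<in> W" "w \<in> U" "v' \<in> W" "w' \<in> U" "edge (v, w) = edge (v', w')"
    then have "{v, w} = {v', w'}"
      by (metis keys_edge)
    with * assms(3) show "v = v' \<and> w = w'"
      by (auto simp: doubleton_eq_iff)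
  qed
  have C_sub: "C \<subseteq> edge ` (W \<times> U)"
  proof
    fix m
    assume m: "m \<in> C"
    then have "m \<in> K" "Poly_Mapping.keys m \<subseteq> W \<union> U"
      using assms(2) by (auto simp: C_def K_def poly_vars_def)
    with m obtain v w where "v \<in> W" "w \<in> U" "v \<in> Poly_Mapping.keys m" "w \<in> Poly_Mapping.keys m"
      unfolding A_def B_def C_def by blast
    with \<open>m \<in> K\<close> monomial_eq_edge[OF deg] assms(3) have "m = edge (v, w)"
      by (auto simp: edge_def)
    with \<open>v \<in> W\<close> \<open>w \<in> U\<close> show "m \<in> edge ` (W \<times> U)"
      by blast
  qed
  have in_C: "edge ` (W \<times> U) \<inter> K \<subseteq> C"
    using assms(3) by (auto simp: A_def B_def C_def keys_edge)
  have zero: "t m x = 0" if "m \<in> edge ` (W \<times> U) - C" for m x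
  proof -
    have "m \<notin> Poly_Mapping.keys p"
      using that in_C unfolding K_def by blast
    then show ?thesis
      by (simp add: t_def in_keys_iff)
  qed
  have C: "(\<Sum>m\<in>C. t m x) = (\<Sum>m\<in>edge ` (W \<times> U). t m x)" for x
    by (rule sum.mono_neutral_left) (use assms(4,5) C_sub zero in auto)
  have edge: "t (edge (v, w)) x = edge_coeff p v w * x v * x w" if "v \<in> W" "w \<in> U" for v w x
  proof -
    have "v \<noteq> w"
      using that assms(3) by auto
    then show ?thesis
      unfolding t_def keys_edge
      by (simp add: edge_def edge_coeff_def lookup_add lookup_single mult.assoc)
  qed
  have C': "(\<Sum>m\<in>C. t m x) = (\<Sum>v\<in>W. \<Sum>w\<in>U. edge_coeff p v w * x v * x w)" for x
  proof -
    have "(\<Sum>m\<in>C. t m x) = (\<Sum>z\<in>W \<times> U. t (edge z) x)"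
      unfolding C by (simp add: sum.reindex[OF inj])
    also have "\<dots> = (\<Sum>(v, w)\<in>W \<times> U. edge_coeff p v w * x v * x w)"
      by (rule sum.cong) (auto simp: edge)
    finally show ?thesis
      by (simp add: sum.cartesian_product)
  qed
  have restrict: "t m x = t m (restrict x S)" if "Poly_Mapping.keys m \<subseteq> S" for m x S
  proof -
    have "(\<Prod>i\<in>Poly_Mapping.keys m. x i ^ Poly_Mapping.lookup m i) =
      (\<Prod>i\<in>Poly_Mapping.keys m. restrict x S i ^ Poly_Mapping.lookup m i)"
      using that by (intro prod.cong) auto
    then show ?thesis
      by (simp add: t_def)
  qed
  have "eval_poly p x = (\<Sum>m\<in>A. t m (restrict x W)) + (\<Sum>m\<in>B. t m (restrict x U)) +
      (\<Sum>v\<in>W. \<Sum>w\<in>U. edge_coeff p v w * x v * x w)" for x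
  proof -
    have "eval_poly p x = (\<Sum>m\<in>A \<union> B \<union> C. t m x)"
      unfolding eval_poly_def t_def by (rule sum.cong) (auto simp: A_def B_def C_def K_def)
    also have "\<dots> = (\<Sum>m\<in>A. t m x) + (\<Sum>m\<in>B. t m x) + (\<Sum>m\<in>C. t m x)"
      using fin by (subst sum.union_disjoint; (subst sum.union_disjoint)?)
        (auto simp: A_def B_def C_def)
    also have "(\<Sum>m\<in>A. t m x) = (\<Sum>m\<in>A. t m (restrict x W))"
      by (rule sum.cong) (auto simp: A_def intro: restrict)
    also have "(\<Sum>m\<in>B. t m x) = (\<Sum>m\<in>B. t m (restrict x U))"
      by (rule sum.cong) (auto simp: B_def intro: restrict)
    finally show ?thesis
      unfolding C' .
  qed
  then show thesis
    by (rule that)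
qed

section \<open>Separability of the bilinear part\<close>

lemma separable_pfun_add_separable:
  assumes "\<And>x. x \<in> Omega n a \<Longrightarrow> f x = g (restrict x W) + h (restrict x ({..n} - W)) + k x"
  shows "separable_pfun n a W f \<longleftrightarrow> separable_pfun n a W k"
proof
  assume "separable_pfun n a W f"
  then obtain f' f'' where f: "\<forall>x\<in>Omega n a. f x = f' (restrict x W) + f'' (restrict x ({..n} - W))"
    unfolding separable_pfun_def by blast
  have "k x = (f' (restrict x W) - g (restrict x W)) +
      (f'' (restrict x ({..n} - W)) - h (restrict x ({..n} - W)))" if "x \<in> Omega n a" for x
    using f assms[OF that] that by (auto simp: algebra_simps)
  then show "separable_pfun n a W k"
    unfolding separable_pfun_def
    by (intro exI[of _ "\<lambda>y. f' y - g y"] exI[of _ "\<lambda>y. f'' y - h y"]) blast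
next
  assume "separable_pfun n a W k"
  then obtain k' k'' where k: "\<forall>x\<in>Omega n a. k x = k' (restrict x W) + k'' (restrict x ({..n} - W))"
    unfolding separable_pfun_def by blast
  then show "separable_pfun n a W f"
    unfolding separable_pfun_def
    by (intro exI[of _ "\<lambda>y. g y + k' y"] exI[of _ "\<lambda>y. h y + k'' y"])
      (auto simp: assms algebra_simps)
qed

lemma bilinear_separable_if_labels:
  fixes E :: "nat \<Rightarrow> nat \<Rightarrow> 'q::prime_card mod_ring"
  assumes "W \<subseteq> {..n}" and E: "\<And>v w. v \<in> W \<Longrightarrow> w \<in> {..n} - W \<Longrightarrow> E v w = l v + l w"
  shows "separable_pfun n a W (\<lambda>x. \<Sum>v\<in>W. \<Sum>w\<in>{..n} - W. E v w * x v * x w)"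
proof -
  let ?U = "{..n} - W"
  let ?f' = "\<lambda>y. (\<Sum>v\<in>W. l v * y v) * (a - (\<Sum>v\<in>W. y v))"
  let ?f'' = "\<lambda>y. (\<Sum>w\<in>?U. l w * y w) * (a - (\<Sum>w\<in>?U. y w))"
  have "(\<Sum>v\<in>W. \<Sum>w\<in>?U. E v w * x v * x w) = ?f' (restrict x W) + ?f'' (restrict x ?U)"
    if x: "x \<in> Omega n a" for x
  proof -
    have "(\<Sum>i\<le>n. x i) = (\<Sum>v\<in>W. x v) + (\<Sum>w\<in>?U. x w)"
      using assms(1) by (simp add: sum.subset_diff add.commute)
    with x have "(\<Sum>v\<in>W. x v) + (\<Sum>w\<in>?U. x w) = a"
      by (simp add: Omega_def)
    then have compl: "a - (\<Sum>v\<in>W. x v) = (\<Sum>w\<in>?U. x w)" "a - (\<Sum>w\<in>?U. x w) = (\<Sum>v\<in>W. x v)"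
      by (auto simp: algebra_simps)
    have "(\<Sum>v\<in>W. \<Sum>w\<in>?U. E v w * x v * x w) =
        (\<Sum>v\<in>W. \<Sum>w\<in>?U. (l v * x v) * x w + x v * (l w * x w))"
      by (intro sum.cong refl) (simp add: E algebra_simps)
    also have "\<dots> = (\<Sum>v\<in>W. l v * x v) * (\<Sum>w\<in>?U. x w) + (\<Sum>v\<in>W. x v) * (\<Sum>w\<in>?U. l w * x w)"
      by (simp add: sum.distrib sum_product)
    also have "\<dots> = ?f' x + ?f'' x"
      unfolding compl by (simp add: mult.commute)
    also have "\<dots> = ?f' (restrict x W) + ?f'' (restrict x ?U)"
      by simp
    finally show ?thesis .
  qed
  then show ?thesis
    unfolding separable_pfun_def by (intro exI[of _ ?f'] exI[of _ ?f'']) blast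
qed

lemma labels_if_bilinear_separable:
  fixes E :: "nat \<Rightarrow> nat \<Rightarrow> 'q::prime_card mod_ring"
  assumes "W \<subseteq> {..n}"
    and "separable_pfun n a W (\<lambda>x. \<Sum>v\<in>W. \<Sum>w\<in>{..n} - W. E v w * x v * x w)"
  shows "\<exists>l. \<forall>v\<in>W. \<forall>w\<in>{..n} - W. E v w = l v + l w"
proof (cases "{..n} - W = {}")
  case False
  let ?U = "{..n} - W"
  obtain w0 where w0: "w0 \<in> ?U"
    using False by blast
  obtain f' f'' where f: "\<forall>x\<in>Omega n a. (\<Sum>v\<in>W. \<Sum>w\<in>?U. E v w * x v * x w) =
      f' (restrict x W) + f'' (restrict x ?U)"
    using assms(2) unfolding separable_pfun_def by blast
  \<comment> \<open>The coordinate sum is \<open>1 + 1 + (a - 2) = a\<close>, also if \<open>w = w0\<close>. The restriction of the point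
    to \<open>W\<close> does not depend on \<open>w\<close>, and the restriction to the complement does not depend on \<open>v\<close>.\<close>
  define e :: "nat \<Rightarrow> nat \<Rightarrow> 'q mod_ring" where "e j = (\<lambda>i. if i = j then 1 else 0)" for j
  define pt where "pt v w = restrict (\<lambda>i. e v i + e w i + (a - 2) * e w0 i) {..n}" for v w
  define lW where "lW v = f' (restrict (e v) W) - (a - 2) * E v w0" for v
  define lU where "lU w = f'' (restrict (\<lambda>i. e w i + (a - 2) * e w0 i) ?U)" for w
  have "E v w = lW v + lU w" if v: "v \<in> W" and w: "w \<in> ?U" for v w
  proof -
    have sum_e: "(\<Sum>i\<in>S. g i * e j i) = (if j \<in> S then g j else 0)" if "finite S"
      for j S and g :: "nat \<Rightarrow> 'q mod_ring"
      using that by (simp add: e_def if_distrib cong: if_cong)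
    have sum_e1: "(\<Sum>i\<le>n. e j i) = 1" if "j \<le> n" for j
      using sum_e[of "{..n}" "\<lambda>_. 1" j] that by simp
    have "(\<Sum>i\<le>n. pt v w i) = 1 + 1 + (a - 2) * 1"
      using v w w0 assms(1)
      by (auto simp: pt_def sum.distrib sum_e1 simp flip: sum_distrib_left)
    then have "pt v w \<in> Omega n a"
      by (auto simp: Omega_def pt_def)
    then have "(\<Sum>v'\<in>W. \<Sum>w'\<in>?U. E v' w' * pt v w v' * pt v w w') =
        f' (restrict (pt v w) W) + f'' (restrict (pt v w) ?U)"
      using f by blast
    also have "restrict (pt v w) W = restrict (e v) W"
      using v w w0 assms(1) by (auto simp: pt_def e_def fun_eq_iff restrict_def)
    also have "restrict (pt v w) ?U = restrict (\<lambda>i. e w i + (a - 2) * e w0 i) ?U"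
      using v w w0 assms(1) by (auto simp: pt_def e_def fun_eq_iff restrict_def)
    finally have "(\<Sum>v'\<in>W. \<Sum>w'\<in>?U. E v' w' * pt v w v' * pt v w w') =
        f' (restrict (e v) W) + lU w"
      unfolding lU_def .
    moreover have "(\<Sum>v'\<in>W. \<Sum>w'\<in>?U. E v' w' * pt v w v' * pt v w w') =
        E v w + (a - 2) * E v w0"
    proof -
      have ptW: "pt v w i = e v i" if "i \<in> W" for i
        using that w w0 assms(1) by (auto simp: pt_def e_def)
      have ptU: "pt v w i = e w i + (a - 2) * e w0 i" if "i \<in> ?U" for i
        using that v by (auto simp: pt_def e_def)
      have fin: "finite W" "finite ?U"
        using assms(1) finite_subset by auto
      have "(\<Sum>v'\<in>W. \<Sum>w'\<in>?U. E v' w' * pt v w v' * pt v w w') =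
          (\<Sum>v'\<in>W. (\<Sum>w'\<in>?U. E v' w' * e w w' + (a - 2) * E v' w' * e w0 w') * e v v')"
        unfolding sum_distrib_right
        by (intro sum.cong refl) (simp add: ptW ptU algebra_simps)
      also have "\<dots> = E v w + (a - 2) * E v w0"
        using v w w0 by (simp add: sum_e[OF fin(1)] sum_e[OF fin(2)] sum.distrib)
      finally show ?thesis .
    qed
    ultimately show ?thesis
      by (simp add: lW_def algebra_simps)
  qed
  then show ?thesis
    by (intro exI[of _ "\<lambda>i. if i \<in> W then lW i else lU i"]) auto
qed auto

lemma separable_in_poly_graph_iff:
  assumes "W \<subseteq> {..n}"
  shows "separable_in W (poly_graph n p) \<longleftrightarrow>
    (\<exists>l. \<forall>v\<in>W. \<forall>w\<in>{..n} - W. edge_coeff p v w = l v + l w)"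
proof
  assume "separable_in W (poly_graph n p)"
  then obtain A where A: "additive_graph A" "verts A = {..n}"
    and sep: "\<forall>v\<in>W. \<forall>w\<in>{..n} - W. weight (graph_sum (poly_graph n p) A) v w = 0"
    by (auto simp: separable_in_def is_switching_def poly_graph_def)
  obtain l where l: "\<forall>v\<le>n. \<forall>w\<le>n. v \<noteq> w \<longrightarrow> weight A v w = l v + l w"
    using A by (auto simp: additive_graph_def)
  have "edge_coeff p v w = - l v + - l w" if "v \<in> W" "w \<in> {..n} - W" for v w
  proof -
    have vw: "v \<le> n" "w \<le> n" "v \<noteq> w"
      using that assms by auto
    have "weight (graph_sum (poly_graph n p) A) v w = 0"
      using sep that by blast
    then have "edge_coeff p v w + weight A v w = 0"
      using vw by (simp add: graph_sum_def poly_graph_def edge_coeff_def)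
    then show ?thesis
      using l vw by (simp add: add_eq_0_iff2)
  qed
  then show "\<exists>l. \<forall>v\<in>W. \<forall>w\<in>{..n} - W. edge_coeff p v w = l v + l w"
    by (intro exI[of _ "\<lambda>v. - l v"]) blast
next
  assume "\<exists>l. \<forall>v\<in>W. \<forall>w\<in>{..n} - W. edge_coeff p v w = l v + l w"
  then obtain l where l: "\<forall>v\<in>W. \<forall>w\<in>{..n} - W. edge_coeff p v w = l v + l w"
    by blast
  define A where "A = \<lparr>verts = {..n}, weight =
    (\<lambda>v w. if v \<in> {..n} \<and> w \<in> {..n} \<and> v \<noteq> w then - l v + - l w else 0)\<rparr>"
  have "additive_graph A"
    unfolding additive_graph_def
    by (intro conjI exI[of _ "\<lambda>v. - l v"]) (auto simp: A_def is_wgraph_def)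
  moreover have "weight (graph_sum (poly_graph n p) A) v w = 0" if "v \<in> W" "w \<in> {..n} - W" for v w
  proof -
    have "edge_coeff p v w = l v + l w" "v \<le> n" "w \<le> n" "v \<noteq> w"
      using l that assms by auto
    then show ?thesis
      by (simp add: graph_sum_def poly_graph_def A_def edge_coeff_def)
  qed
  moreover have "verts A = {..n}" "verts (poly_graph n p) = {..n}"
    by (simp_all add: A_def poly_graph_def)
  ultimately show "separable_in W (poly_graph n p)"
    using assms unfolding separable_in_def is_switching_def by metis
qed

lemma separable_pfun_iff_separable_in:
  assumes "quadratic_poly p" "represents n a p f" "W \<subseteq> {..n}"
  shows "separable_pfun n a W f \<longleftrightarrow> separable_in W (poly_graph n p)"
proof -
  let ?B = "\<lambda>x. \<Sum>v\<in>W. \<Sum>w\<in>{..n} - W. edge_coeff p v w * x v * x w"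
  have p: "poly_vars p \<subseteq> W \<union> ({..n} - W)" "\<forall>x\<in>Omega n a. eval_poly p x = f x"
    using assms(2) by (auto simp: represents_def)
  have fin: "finite W"
    using assms(3) finite_subset by blast
  obtain g h where gh:
    "\<And>x. eval_poly p x = g (restrict x W) + h (restrict x ({..n} - W)) + ?B x"
    by (rule eval_poly_quadratic_split[OF assms(1) p(1)]) (use fin in auto)
  have "separable_pfun n a W f \<longleftrightarrow> separable_pfun n a W ?B"
    by (rule separable_pfun_add_separable[of _ _ _ g _ h]) (use p(2) gh in auto)
  also have "\<dots> \<longleftrightarrow> (\<exists>l. \<forall>v\<in>W. \<forall>w\<in>{..n} - W. edge_coeff p v w = l v + l w)"
    using bilinear_separable_if_labels[OF assms(3)] labels_if_bilinear_separable[OF assms(3)]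
    by blast
  also have "\<dots> \<longleftrightarrow> separable_in W (poly_graph n p)"
    using separable_in_poly_graph_iff[OF assms(3)] by blast
  finally show ?thesis .
qed

theorem mainTheorem3:
  fixes n :: nat
    and a :: "'q::prime_card mod_ring"
    and f :: "(nat \<Rightarrow> 'q mod_ring) \<Rightarrow> 'q mod_ring"
    and W :: "nat set"
  assumes "quadratic_pfun n a f"
    and "W \<subseteq> {..n}"
  shows "separable_pfun n a W f \<longleftrightarrow>
    (\<forall>p. quadratic_poly p \<and> represents n a p f \<longrightarrow> separable_in W (poly_graph n p))"
  using quadratic_pfunE[OF assms(1)] separable_pfun_iff_separable_in[OF _ _ assms(2)]
  by metis

end
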